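(* Let $x$ be a positive real number and let $\alpha(x),\omega_1(x),\omega_2(x)$ be the three roots in $\mathbb{C}$ of $\lambda^3-x^2\lambda^2-x\lambda-1=0$. Put $\underline{\alpha}=1+\alpha(x)\mathbf{i}+\alpha^2(x)\mathbf{j}+\alpha^3(x)\mathbf{k}$, $\underline{\omega_1}=1+\omega_1(x)\mathbf{i}+\omega_1^2(x)\mathbf{j}+\omega_1^3(x)\mathbf{k}$ and $\underline{\omega_2}=1+\omega_2(x)\mathbf{i}+\omega_2^2(x)\mathbf{j}+\omega_2^3(x)\mathbf{k}$. Then for every integer $n\ge 0$, $$Q_{T,n}(x)=\frac{\underline{\alpha}\,\alpha^{n+1}(x)}{(\alpha(x)-\omega_1(x))(\alpha(x)-\omega_2(x))}-\frac{\underline{\omega_1}\,\omega_1^{n+1}(x)}{(\alpha(x)-\omega_1(x))(\omega_1(x)-\omega_2(x))}+\frac{\underline{\omega_2}\,\omega_2^{n+1}(x)}{(\alpha(x)-\omega_2(x))(\omega_1(x)-\omega_2(x))}$$ and $$Q_{t,n}(x)=\underline{\alpha}\,\alpha^{n}(x)+\underline{\omega_1}\,\omega_1^{n}(x)+\underline{\omega_2}\,\omega_2^{n}(x).$$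
   Context: The Tribonacci polynomials $T_n(x)$ and Tribonacci-Lucas polynomials $t_n(x)$ are defined by $T_0(x)=0$, $T_1(x)=1$, $T_2(x)=x^2$, $t_0(x)=3$, $t_1(x)=x^2$, $t_2(x)=x^4+2x$, and for $n\ge 3$: $T_n(x)=x^2T_{n-1}(x)+xT_{n-2}(x)+T_{n-3}(x)$ and $t_n(x)=x^2t_{n-1}(x)+xt_{n-2}(x)+t_{n-3}(x)$. Let $\mathbf{i},\mathbf{j},\mathbf{k}$ be the quaternion units, with $\mathbf{i}^2=\mathbf{j}^2=\mathbf{k}^2=\mathbf{i}\mathbf{j}\mathbf{k}=-1$. For $n\ge 0$, the Tribonacci quaternion polynomials are $Q_{T,n}(x)=T_n(x)+T_{n+1}(x)\mathbf{i}+T_{n+2}(x)\mathbf{j}+T_{n+3}(x)\mathbf{k}$ and the Tribonacci-Lucas quaternion polynomials are $Q_{t,n}(x)=t_n(x)+t_{n+1}(x)\mathbf{i}+t_{n+2}(x)\mathbf{j}+t_{n+3}(x)\mathbf{k}$. Since the roots may be non-real complex numbers, the identities are understood in the complexified quaternion algebra $\mathbb{C}\otimes_{\mathbb{R}}\mathbb{H}$, in which complex scalars commute with $\mathbf{i},\mathbf{j},\mathbf{k}$ (the complex imaginary unit is distinct from $\mathbf{i}$). Powers such as $\alpha^n(x)$ mean $(\alpha(x))^n$. *)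

theory Defs
  imports "HOL-Computational_Algebra.Computational_Algebra"
begin

text \<open>
  Hamilton's quaternions with coefficients in a commutative ring \<open>R\<close>, i.e. the free \<open>R\<close>-module
  on \<open>1, i, j, k\<close>. Thus \<open>real quat\<close> is the usual algebra \<open>H\<close>, and \<open>complex quat\<close> is its
  complexification (the tensor product of \<open>C\<close> and \<open>H\<close> over \<open>R\<close>): there the imaginary unit
  of \<open>C\<close> is a central scalar, distinct from the quaternion unit \<open>i\<close>.
\<close>

datatype 'a quat = Quat (qre: 'a) (qim1: 'a) (qim2: 'a) (qim3: 'a)

instantiation quat :: (comm_ring_1) ring_1
begin

definition "0 = Quat 0 0 0 0"
definition "1 = Quat 1 0 0 0"
definition "p + q = Quat (qre p + qre q) (qim1 p + qim1 q) (qim2 p + qim2 q) (qim3 p + qim3 q)"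
definition "- p = Quat (- qre p) (- qim1 p) (- qim2 p) (- qim3 p)"
definition "p - q = Quat (qre p - qre q) (qim1 p - qim1 q) (qim2 p - qim2 q) (qim3 p - qim3 q)"
definition "p * q = Quat
  (qre p * qre q - qim1 p * qim1 q - qim2 p * qim2 q - qim3 p * qim3 q)
  (qre p * qim1 q + qim1 p * qre q + qim2 p * qim3 q - qim3 p * qim2 q)
  (qre p * qim2 q - qim1 p * qim3 q + qim2 p * qre q + qim3 p * qim1 q)
  (qre p * qim3 q + qim1 p * qim2 q - qim2 p * qim1 q + qim3 p * qre q)"

lemmas quat_arith_defs = zero_quat_def one_quat_def plus_quat_def uminus_quat_def
  minus_quat_def times_quat_def

instance
  by standard (auto simp: quat_arith_defs algebra_simps)

end

definition quat_i :: "'a::comm_ring_1 quat" where "quat_i = Quat 0 1 0 0"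
definition quat_j :: "'a::comm_ring_1 quat" where "quat_j = Quat 0 0 1 0"
definition quat_k :: "'a::comm_ring_1 quat" where "quat_k = Quat 0 0 0 1"

definition quat_of :: "'a::comm_ring_1 \<Rightarrow> 'a quat"
  where "quat_of c = Quat c 0 0 0"

lemma quat_units:
  "quat_i * quat_i = (- 1 :: 'a::comm_ring_1 quat)"
  "quat_j * quat_j = (- 1 :: 'a quat)"
  "quat_k * quat_k = (- 1 :: 'a quat)"
  "quat_i * quat_j * quat_k = (- 1 :: 'a quat)"
  by (simp_all add: quat_i_def quat_j_def quat_k_def quat_arith_defs)

lemma Quat_eq: "Quat a b c d = quat_of a + quat_of b * quat_i + quat_of c * quat_j + quat_of d * quat_k"
  by (simp add: quat_of_def quat_i_def quat_j_def quat_k_def quat_arith_defs)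

lemma quat_of_hom:
  "quat_of 0 = 0" "quat_of 1 = 1"
  "quat_of (a + b) = quat_of a + quat_of b"
  "quat_of (a * b) = quat_of a * quat_of b"
  by (simp_all add: quat_of_def quat_arith_defs)

lemma quat_of_central: "quat_of c * q = q * quat_of c"
  by (simp add: quat_of_def quat_arith_defs mult.commute)

text \<open>The canonical embedding \<open>q \<mapsto> 1 \<otimes> q\<close> of \<open>H\<close> into its complexification.\<close>

definition complexify :: "real quat \<Rightarrow> complex quat"
  where "complexify = map_quat complex_of_real"

lemma complexify_hom:
  "complexify 1 = 1"
  "complexify (p + q) = complexify p + complexify q"
  "complexify (p * q) = complexify p * complexify q"
  by (cases p; cases q; simp add: complexify_def quat_arith_defs)+

lemma complexify_of_units:
  "complexify (quat_of r) = quat_of (complex_of_real r)"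
  "complexify quat_i = quat_i" "complexify quat_j = quat_j" "complexify quat_k = quat_k"
  by (simp_all add: complexify_def quat_of_def quat_i_def quat_j_def quat_k_def)

fun tribonacci_poly :: "nat \<Rightarrow> real poly" where
  "tribonacci_poly 0 = 0"
| "tribonacci_poly (Suc 0) = 1"
| "tribonacci_poly (Suc (Suc 0)) = [:0, 1:] ^ 2"
| "tribonacci_poly (Suc (Suc (Suc n))) =
     [:0, 1:] ^ 2 * tribonacci_poly (Suc (Suc n)) + [:0, 1:] * tribonacci_poly (Suc n)
     + tribonacci_poly n"

fun tribonacci_lucas_poly :: "nat \<Rightarrow> real poly" where
  "tribonacci_lucas_poly 0 = 3"
| "tribonacci_lucas_poly (Suc 0) = [:0, 1:] ^ 2"
| "tribonacci_lucas_poly (Suc (Suc 0)) = [:0, 1:] ^ 4 + 2 * [:0, 1:]"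
| "tribonacci_lucas_poly (Suc (Suc (Suc n))) =
     [:0, 1:] ^ 2 * tribonacci_lucas_poly (Suc (Suc n)) + [:0, 1:] * tribonacci_lucas_poly (Suc n)
     + tribonacci_lucas_poly n"

definition tribonacci_quat :: "nat \<Rightarrow> real \<Rightarrow> real quat" where
  "tribonacci_quat n x =
     quat_of (poly (tribonacci_poly n) x)
     + quat_of (poly (tribonacci_poly (n + 1)) x) * quat_i
     + quat_of (poly (tribonacci_poly (n + 2)) x) * quat_j
     + quat_of (poly (tribonacci_poly (n + 3)) x) * quat_k"

definition tribonacci_lucas_quat :: "nat \<Rightarrow> real \<Rightarrow> real quat" where
  "tribonacci_lucas_quat n x =
     quat_of (poly (tribonacci_lucas_poly n) x)
     + quat_of (poly (tribonacci_lucas_poly (n + 1)) x) * quat_i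
     + quat_of (poly (tribonacci_lucas_poly (n + 2)) x) * quat_j
     + quat_of (poly (tribonacci_lucas_poly (n + 3)) x) * quat_k"

definition root_quat :: "complex \<Rightarrow> complex quat" where
  "root_quat z = 1 + quat_of z * quat_i + quat_of (z ^ 2) * quat_j + quat_of (z ^ 3) * quat_k"

end

theory Submission
  imports Defs
begin

text \<open>
  Write the characteristic cubic as \<open>(X - a) (X - b) (X - c)\<close>. Each of the sequences \<open>a ^ n\<close>,
  \<open>b ^ n\<close>, \<open>c ^ n\<close> satisfies the third-order recurrence shared by the Tribonacci and the
  Tribonacci-Lucas polynomials evaluated at \<open>x\<close>, and so does every linear combination of them. A
  solution is determined by its first three values, so each identity between scalars
  reduces to three identities in \<open>a, b, c\<close> (\<open>tribonacci_binet\<close>, \<open>tribonacci_lucas_binet\<close>);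
  Vieta's formulas express the coefficients and initial values through the roots.

  The quaternion identities then follow componentwise: multiplying the geometric sequence
  \<open>w z ^ n\<close> by \<open>z, z\<^sup>2, z\<^sup>3\<close> shifts it by one, two, three places, so a quaternion formed from
  four consecutive terms of such a sequence is \<open>root_quat z\<close> times the scalar \<open>w z ^ n\<close>.

  The denominators in the Tribonacci formula do not vanish: the discriminant of the cubic is
  \<open>- 3 x ^ 6 - 14 x ^ 3 - 27\<close>, a quadratic in \<open>x ^ 3\<close> which is negative for every real \<open>x\<close>, so the
  three roots are distinct (\<open>tribonacci_roots_distinct\<close>).
\<close>

lemma proots_cubic_vieta:
  fixes a b c p q r :: complex
  assumes "proots [:r, q, p, 1:] = {#a, b, c#}"
  shows "p = - (a + b + c)" "q = a * b + a * c + b * c" "r = - (a * b * c)"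
proof -
  have "lead_coeff [:r, q, p, 1:] = 1"
    by simp
  then have "[:r, q, p, 1:] = (\<Prod>z\<in>#{#a, b, c#}. [:- z, 1:])"
    using complex_poly_decompose_multiset[of "[:r, q, p, 1:]"] unfolding assms
    by (metis smult_1_left)
  also have "\<dots> = [:- (a * b * c), a * b + a * c + b * c, - (a + b + c), 1:]"
    by (simp add: algebra_simps)
  finally show "p = - (a + b + c)" "q = a * b + a * c + b * c" "r = - (a * b * c)"
    by simp_all
qed

text \<open>
  The discriminant, a symmetric function of the roots, in terms of the coefficients: this decides
  whether the roots are distinct without solving the cubic.
\<close>
lemma cubic_discriminant:
  fixes a b c :: "'a::comm_ring_1"
  defines "s \<equiv> a + b + c" and "e \<equiv> a * b + a * c + b * c" and "t \<equiv> a * b * c"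
  shows "((a - b) * (a - c) * (b - c)) ^ 2
    = s ^ 2 * e ^ 2 - 4 * e ^ 3 - 4 * s ^ 3 * t + 18 * s * e * t - 27 * t ^ 2"
  unfolding s_def e_def t_def by (simp add: power2_eq_square power3_eq_cube algebra_simps)

lemma tribonacci_roots_distinct:
  fixes x :: real and a b c :: complex
  assumes "a + b + c = of_real x ^ 2" "a * b + a * c + b * c = - of_real x" "a * b * c = 1"
  shows "a \<noteq> b" "a \<noteq> c" "b \<noteq> c"
proof -
  have "((a - b) * (a - c) * (b - c)) ^ 2 = of_real (- 3 * x ^ 6 - 14 * x ^ 3 - 27)"
    unfolding cubic_discriminant assms
    by (simp add: power2_eq_square power3_eq_cube eval_nat_numeral algebra_simps)
  moreover have "- 3 * x ^ 6 - 14 * x ^ 3 - 27 < 0"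
  proof -
    have "- 3 * x ^ 6 - 14 * x ^ 3 - 27 = - 3 * (x ^ 3 + 7 / 3) ^ 2 - 32 / 3"
      by (simp add: power2_eq_square eval_nat_numeral algebra_simps)
    also have "\<dots> < 0"
      using zero_le_power2[of "x ^ 3 + 7 / 3"] by linarith
    finally show ?thesis .
  qed
  ultimately have "((a - b) * (a - c) * (b - c)) ^ 2 \<noteq> 0"
    by (metis less_irrefl of_real_eq_0_iff)
  then show "a \<noteq> b" "a \<noteq> c" "b \<noteq> c"
    by auto
qed

lemma third_order_recurrence_unique:
  fixes f g :: "nat \<Rightarrow> 'a::comm_ring_1"
  assumes f: "\<And>n. f (n + 3) = p * f (n + 2) + q * f (n + 1) + r * f n"
    and g: "\<And>n. g (n + 3) = p * g (n + 2) + q * g (n + 1) + r * g n"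
    and init: "f 0 = g 0" "f 1 = g 1" "f 2 = g 2"
  shows "f n = g n"
proof -
  have "f n = g n \<and> f (n + 1) = g (n + 1) \<and> f (n + 2) = g (n + 2)"
    by (induction n) (use init f g in \<open>simp_all add: numeral_eq_Suc\<close>)
  then show ?thesis
    by simp
qed

lemma root_power_recurrence:
  fixes a b c z :: "'a::comm_ring_1"
  assumes "z \<in> {a, b, c}"
  shows "z ^ (n + 3) = (a + b + c) * z ^ (n + 2) + - (a * b + a * c + b * c) * z ^ (n + 1)
    + a * b * c * z ^ n"
proof -
  have cubic: "z ^ 3 = (a + b + c) * z ^ 2 - (a * b + a * c + b * c) * z + a * b * c"
    using assms by (auto simp: power2_eq_square power3_eq_cube algebra_simps)
  show ?thesis
    unfolding power_add power_one_right cubic by (simp add: algebra_simps)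
qed

text \<open>
  The right-hand side is the complete homogeneous symmetric polynomial of degree \<open>n - 1\<close> in the
  three roots (zero for \<open>n = 0\<close>), which explains the initial values \<open>0, 1, a + b + c\<close>.
\<close>
lemma tribonacci_binet:
  fixes f :: "nat \<Rightarrow> 'a::field"
  assumes rec: "\<And>n. f (n + 3) = (a + b + c) * f (n + 2) + - (a * b + a * c + b * c) * f (n + 1)
      + a * b * c * f n"
    and init: "f 0 = 0" "f 1 = 1" "f 2 = a + b + c"
    and distinct: "a \<noteq> b" "a \<noteq> c" "b \<noteq> c"
  shows "f n = a ^ (n + 1) / ((a - b) * (a - c)) - b ^ (n + 1) / ((a - b) * (b - c))
    + c ^ (n + 1) / ((a - c) * (b - c))"
proof -
  define u v w where "u = a / ((a - b) * (a - c))" and "v = - b / ((a - b) * (b - c))"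
    and "w = c / ((a - c) * (b - c))"
  have nz: "a - b \<noteq> 0" "a - c \<noteq> 0" "b - c \<noteq> 0"
    using distinct by auto
  \<comment> \<open>Over the common denominator the numerators are alternating in the roots; for \<open>k = 0, 1, 2\<close> they
    are the Vandermonde product times \<open>0, 1, a + b + c\<close>.\<close>
  have D: "a ^ k * u + b ^ k * v + c ^ k * w
      = (a ^ (k + 1) * (b - c) - b ^ (k + 1) * (a - c) + c ^ (k + 1) * (a - b))
        / ((a - b) * (a - c) * (b - c))" for k
    using nz unfolding u_def v_def w_def
    by (simp add: add_divide_distrib diff_divide_distrib mult_ac)
  have "f n = a ^ n * u + b ^ n * v + c ^ n * w"
  proof (rule third_order_recurrence_unique[where f = f and p = "a + b + c"
        and q = "- (a * b + a * c + b * c)" and r = "a * b * c"])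
    show "f (n + 3) = (a + b + c) * f (n + 2) + - (a * b + a * c + b * c) * f (n + 1)
      + a * b * c * f n" for n
      by (fact rec)
    show "a ^ (n + 3) * u + b ^ (n + 3) * v + c ^ (n + 3) * w
      = (a + b + c) * (a ^ (n + 2) * u + b ^ (n + 2) * v + c ^ (n + 2) * w)
        + - (a * b + a * c + b * c) * (a ^ (n + 1) * u + b ^ (n + 1) * v + c ^ (n + 1) * w)
        + a * b * c * (a ^ n * u + b ^ n * v + c ^ n * w)" for n
      unfolding root_power_recurrence[of a a b c, OF insertI1]
        root_power_recurrence[of b a b c, OF insertI2[OF insertI1]]
        root_power_recurrence[of c a b c, OF insertI2[OF insertI2[OF insertI1]]]
      by (simp add: algebra_simps)
    show "f 0 = a ^ 0 * u + b ^ 0 * v + c ^ 0 * w"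
      unfolding D init by (simp add: algebra_simps)
    show "f 1 = a ^ 1 * u + b ^ 1 * v + c ^ 1 * w"
      unfolding D init using nz
      by (simp add: eq_divide_eq) (simp add: power2_eq_square eval_nat_numeral algebra_simps)
    show "f 2 = a ^ 2 * u + b ^ 2 * v + c ^ 2 * w"
      unfolding D init using nz
      by (simp add: eq_divide_eq) (simp add: power2_eq_square eval_nat_numeral algebra_simps)
  qed
  then show ?thesis
    by (simp add: u_def v_def w_def mult.commute)
qed

text \<open>The values \<open>f n\<close> are the power sums of the roots; the initial ones are Newton's identities.\<close>
lemma tribonacci_lucas_binet:
  fixes f :: "nat \<Rightarrow> 'a::comm_ring_1"
  assumes rec: "\<And>n. f (n + 3) = (a + b + c) * f (n + 2) + - (a * b + a * c + b * c) * f (n + 1)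
      + a * b * c * f n"
    and init: "f 0 = 3" "f 1 = a + b + c" "f 2 = (a + b + c) ^ 2 - 2 * (a * b + a * c + b * c)"
  shows "f n = a ^ n + b ^ n + c ^ n"
proof (rule third_order_recurrence_unique[where f = f and p = "a + b + c"
      and q = "- (a * b + a * c + b * c)" and r = "a * b * c"])
  show "f (n + 3) = (a + b + c) * f (n + 2) + - (a * b + a * c + b * c) * f (n + 1)
    + a * b * c * f n" for n
    by (fact rec)
  show "a ^ (n + 3) + b ^ (n + 3) + c ^ (n + 3)
    = (a + b + c) * (a ^ (n + 2) + b ^ (n + 2) + c ^ (n + 2))
      + - (a * b + a * c + b * c) * (a ^ (n + 1) + b ^ (n + 1) + c ^ (n + 1))
      + a * b * c * (a ^ n + b ^ n + c ^ n)" for n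
    unfolding root_power_recurrence[of a a b c, OF insertI1]
      root_power_recurrence[of b a b c, OF insertI2[OF insertI1]]
      root_power_recurrence[of c a b c, OF insertI2[OF insertI2[OF insertI1]]]
    by (simp add: algebra_simps)
  show "f 0 = a ^ 0 + b ^ 0 + c ^ 0" "f 1 = a ^ 1 + b ^ 1 + c ^ 1"
    using init by simp_all
  show "f 2 = a ^ 2 + b ^ 2 + c ^ 2"
    unfolding init by (simp add: power2_eq_square algebra_simps)
qed

text \<open>
  With \<open>w\<close> a multiple of \<open>z ^ n\<close>, the four components are consecutive terms of a geometric sequence of
  ratio \<open>z\<close>; this is what turns the scalar formulas into quaternion ones.
\<close>
lemma root_quat_times_scalar: "root_quat z * quat_of w = Quat w (z * w) (z ^ 2 * w) (z ^ 3 * w)"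
  by (simp add: root_quat_def quat_of_def quat_i_def quat_j_def quat_k_def quat_arith_defs)

lemma complexify_tribonacci_quat:
  fixes x :: real
  defines "T \<equiv> \<lambda>n. complex_of_real (poly (tribonacci_poly n) x)"
  shows "complexify (tribonacci_quat n x) = Quat (T n) (T (n + 1)) (T (n + 2)) (T (n + 3))"
  unfolding T_def tribonacci_quat_def Quat_eq[symmetric] by (simp add: complexify_def)

lemma complexify_tribonacci_lucas_quat:
  fixes x :: real
  defines "t \<equiv> \<lambda>n. complex_of_real (poly (tribonacci_lucas_poly n) x)"
  shows "complexify (tribonacci_lucas_quat n x) = Quat (t n) (t (n + 1)) (t (n + 2)) (t (n + 3))"
  unfolding t_def tribonacci_lucas_quat_def Quat_eq[symmetric] by (simp add: complexify_def)

theorem theorem2p3: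
  fixes x :: real and \<alpha> \<omega>\<^sub>1 \<omega>\<^sub>2 :: complex and n :: nat
  assumes "x > 0"
    and "proots [:- 1, - complex_of_real x, - (complex_of_real x ^ 2), 1:] = {#\<alpha>, \<omega>\<^sub>1, \<omega>\<^sub>2#}"
  shows "complexify (tribonacci_quat n x) =
           root_quat \<alpha> * quat_of (\<alpha> ^ (n + 1) / ((\<alpha> - \<omega>\<^sub>1) * (\<alpha> - \<omega>\<^sub>2)))
           - root_quat \<omega>\<^sub>1 * quat_of (\<omega>\<^sub>1 ^ (n + 1) / ((\<alpha> - \<omega>\<^sub>1) * (\<omega>\<^sub>1 - \<omega>\<^sub>2)))
           + root_quat \<omega>\<^sub>2 * quat_of (\<omega>\<^sub>2 ^ (n + 1) / ((\<alpha> - \<omega>\<^sub>2) * (\<omega>\<^sub>1 - \<omega>\<^sub>2)))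
         \<and> complexify (tribonacci_lucas_quat n x) =
           root_quat \<alpha> * quat_of (\<alpha> ^ n) + root_quat \<omega>\<^sub>1 * quat_of (\<omega>\<^sub>1 ^ n)
           + root_quat \<omega>\<^sub>2 * quat_of (\<omega>\<^sub>2 ^ n)"
proof -
  have s: "\<alpha> + \<omega>\<^sub>1 + \<omega>\<^sub>2 = complex_of_real x ^ 2"
    and e: "\<alpha> * \<omega>\<^sub>1 + \<alpha> * \<omega>\<^sub>2 + \<omega>\<^sub>1 * \<omega>\<^sub>2 = - complex_of_real x"
    and t: "\<alpha> * \<omega>\<^sub>1 * \<omega>\<^sub>2 = 1"
    using proots_cubic_vieta[OF assms(2)] by (metis add.inverse_inverse)+
  note distinct = tribonacci_roots_distinct[OF s e t]
  have T: "complex_of_real (poly (tribonacci_poly m) x)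
      = \<alpha> ^ (m + 1) / ((\<alpha> - \<omega>\<^sub>1) * (\<alpha> - \<omega>\<^sub>2)) - \<omega>\<^sub>1 ^ (m + 1) / ((\<alpha> - \<omega>\<^sub>1) * (\<omega>\<^sub>1 - \<omega>\<^sub>2))
        + \<omega>\<^sub>2 ^ (m + 1) / ((\<alpha> - \<omega>\<^sub>2) * (\<omega>\<^sub>1 - \<omega>\<^sub>2))" for m
    by (rule tribonacci_binet) (use distinct in \<open>simp_all add: s e t[unfolded mult.assoc] numeral_eq_Suc distrib_left mult.assoc\<close>)
  have L: "complex_of_real (poly (tribonacci_lucas_poly m) x) = \<alpha> ^ m + \<omega>\<^sub>1 ^ m + \<omega>\<^sub>2 ^ m" for m
    by (rule tribonacci_lucas_binet) (simp_all add: s e t[unfolded mult.assoc] numeral_eq_Suc distrib_left mult.assoc)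
  show ?thesis
    unfolding complexify_tribonacci_quat complexify_tribonacci_lucas_quat T L
      root_quat_times_scalar
    by (simp add: quat_arith_defs power_add eval_nat_numeral mult_ac)
qed

end
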